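(* Under the setting described in the context, and assuming the feasible set $\Omega$ is nonempty, the supremum $C=\sup_{F\in\Omega} I(F)$ is attained by a unique input distribution $F^*\in\Omega$, i.e. $C=I(F^* )$, and $F^*$ is the only element of $\Omega$ with $I(F^* )=C$.
   Context: Fix constants $A>0$ (peak-power constraint), $\varepsilon>0$ (average-power constraint), $E_{th}\ge 0$ (energy-harvesting threshold), $b>0$, $c>0$, and a gain $\kappa=aR_Ph_{1,l}>0$. Channel: $Y=\kappa H_t X+N$, where $X\ge 0$ is the input, $H_t=e^{2X_l}$ with $X_l\sim\mathcal N(\mu_{X_l},\sigma_{X_l}^2)$, $\mu_{X_l}=-\sigma_{X_l}^2$, $\sigma_{X_l}^2>0$ (lognormal fading), $N\sim\mathcal N(0,\sigma_g^2)$, with $X,H_t,N$ mutually independent. Let $p(y|x)$ denote the conditional density of $Y$ given $X=x$. For a probability distribution $F$ on $[0,A]$, let $p(y;F)=\int_0^A p(y|x)\,dF(x)$, the information density $i(x;F)=\int_{\mathbb R} p(y|x)\log_2\frac{p(y|x)}{p(y;F)}\,dy$, and the mutual information $I(F)=\int_0^A i(x;F)\,dF(x)$. Define $g_1(F)=\int_0^A x\,dF(x)-\varepsilon$ and $g_2(F)=E_{th}-\int_0^A b x\ln(1+cx)\,dF(x)$, and $\Omega=\{F$ probability distribution supported on $[0,A]$ : $g_1(F)\le 0,\ g_2(F)\le 0\}$. The capacity is $C=\sup_{F\in\Omega}I(F)$. *)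

theory Defs
  imports "HOL-Probability.Probability"
begin

text \<open>Channel Y = kappa * H_t * X + N with H_t = exp(2 X_l), X_l ~ N(-sl^2, sl^2)
  (sl = standard deviation of X_l), N ~ N(0, sg^2) (sg = standard deviation of N).
  cond_dens is the conditional density p(y|x) of Y given X = x.\<close>

definition cond_dens :: "real \<Rightarrow> real \<Rightarrow> real \<Rightarrow> real \<Rightarrow> real \<Rightarrow> real" where
  "cond_dens \<kappa> sl sg x y =
     (\<integral>t. normal_density (- sl\<^sup>2) sl t * normal_density 0 sg (y - \<kappa> * exp (2 * t) * x) \<partial>lborel)"

definition out_dens :: "real \<Rightarrow> real \<Rightarrow> real \<Rightarrow> real measure \<Rightarrow> real \<Rightarrow> real" where
  "out_dens \<kappa> sl sg F y = (\<integral>x. cond_dens \<kappa> sl sg x y \<partial>F)"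

definition info_dens :: "real \<Rightarrow> real \<Rightarrow> real \<Rightarrow> real measure \<Rightarrow> real \<Rightarrow> real" where
  "info_dens \<kappa> sl sg F x =
     (\<integral>y. cond_dens \<kappa> sl sg x y * log 2 (cond_dens \<kappa> sl sg x y / out_dens \<kappa> sl sg F y) \<partial>lborel)"

definition mutual_info :: "real \<Rightarrow> real \<Rightarrow> real \<Rightarrow> real measure \<Rightarrow> real" where
  "mutual_info \<kappa> sl sg F = (\<integral>x. info_dens \<kappa> sl sg F x \<partial>F)"

text \<open>Feasible set Omega: Borel probability distributions on the reals supported on [0,A]
  with average-power and energy-harvesting constraints.\<close>
definition feasible :: "real \<Rightarrow> real \<Rightarrow> real \<Rightarrow> real \<Rightarrow> real \<Rightarrow> real measure set" where
  "feasible A \<epsilon> Eth b c =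
     {F. prob_space F \<and> sets F = sets borel \<and> measure F {0..A} = 1
         \<and> (\<integral>x. x \<partial>F) - \<epsilon> \<le> 0
         \<and> Eth - (\<integral>x. b * x * ln (1 + c * x) \<partial>F) \<le> 0}"

end

theory Submission
  imports Defs
begin

text \<open>
  On inputs supported in [0, A] the kernel p(y|x) lies between exp (- C (1 + y^2)) and
  D / (1 + y^2)^2, uniformly in x. Hence every entropy-like integrand is dominated by a multiple of
  1 / (1 + y^2), mutual information splits as a linear functional of F minus the integral of
  p(y;F) log p(y;F), and dominated convergence makes it continuous for weak convergence; as the
  feasible set is weakly sequentially compact by Helly's theorem, the supremum is attained.
  For uniqueness, strict convexity of t log t along the midpoint of two maximizers forces their
  output densities to agree almost everywhere. The n-th moment of the output is a polynomial of
  degree n in the input moments whose leading coefficient, a fading moment, is positive; so the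
  input moments agree, and these determine a compactly supported distribution.
\<close>

section \<open>Elementary integrability facts and Gaussian estimates\<close>

lemma integrable_inverse_1_plus_square_lborel: "integrable lborel (\<lambda>y::real. 1 / (1 + y\<^sup>2))"
  using integrable_inverse_1_plus_square
  by (simp add: set_integrable_def einterval_def inverse_eq_divide)

lemma (in pair_sigma_finite) integrable_mult_pair:
  fixes f :: "'a \<Rightarrow> real" and g :: "'b \<Rightarrow> real"
  assumes f: "integrable M1 f" and g: "integrable M2 g"
  shows "integrable (M1 \<Otimes>\<^sub>M M2) (\<lambda>(x, y). f x * g y)"
proof (rule Fubini_integrable)
  have [measurable]: "f \<in> borel_measurable M1" "g \<in> borel_measurable M2"
    using f g by auto
  show "(\<lambda>(x, y). f x * g y) \<in> borel_measurable (M1 \<Otimes>\<^sub>M M2)"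
    by measurable
  show "integrable M1 (\<lambda>x. \<integral>y. norm (case (x, y) of (x, y) \<Rightarrow> f x * g y) \<partial>M2)"
    using f by (simp add: abs_mult)
  show "AE x in M1. integrable M2 (\<lambda>y. case (x, y) of (x, y) \<Rightarrow> f x * g y)"
    using g by simp
qed

text \<open>The n-th term of the exponential series at \<open>a * (1 + u\<^sup>2)\<close> controls
  the polynomial factor, and with \<open>a = 1 / (2 * \<sigma>\<^sup>2)\<close> the resulting
  \<open>exp (a * u\<^sup>2)\<close> is cancelled by the Gaussian.\<close>

lemma normal_density_mult_power_bounded:
  assumes "\<sigma> > 0"
  obtains C where "C > 0" "\<And>u. normal_density 0 \<sigma> u * (1 + u\<^sup>2) ^ n \<le> C"
proof -
  define a where "a = 1 / (2 * \<sigma>\<^sup>2)"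
  have a: "a > 0" using assms by (simp add: a_def)
  define C where "C = 1 / sqrt (2 * pi * \<sigma>\<^sup>2) * (fact n / a ^ n * exp a)"
  have "normal_density 0 \<sigma> u * (1 + u\<^sup>2) ^ n \<le> C" for u
  proof -
    have "(a * (1 + u\<^sup>2)) ^ n / fact n \<le> exp (a * (1 + u\<^sup>2))"
    proof -
      have "(\<Sum>i\<in>{n}. (a * (1 + u\<^sup>2)) ^ i /\<^sub>R fact i) \<le> (\<Sum>i. (a * (1 + u\<^sup>2)) ^ i /\<^sub>R fact i)"
        using a by (intro sum_le_suminf summable_exp_generic) auto
      then show ?thesis by (simp add: exp_def divide_inverse mult.commute)
    qed
    then have "(1 + u\<^sup>2) ^ n \<le> fact n / a ^ n * exp (a * (1 + u\<^sup>2))"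
      using a unfolding power_mult_distrib by (simp add: divide_simps mult.commute)
    then have "exp (- (a * u\<^sup>2)) * (1 + u\<^sup>2) ^ n
      \<le> exp (- (a * u\<^sup>2)) * (fact n / a ^ n * exp (a * (1 + u\<^sup>2)))"
      by (intro mult_left_mono) auto
    also have "\<dots> = fact n / a ^ n * exp a"
      by (simp add: distrib_left exp_add exp_minus)
    finally have "1 / sqrt (2 * pi * \<sigma>\<^sup>2) * (exp (- (a * u\<^sup>2)) * (1 + u\<^sup>2) ^ n) \<le> C"
      unfolding C_def by (intro mult_left_mono) auto
    then show ?thesis
      by (simp add: normal_density_def a_def)
  qed
  moreover have "C > 0" using a assms by (simp add: C_def)
  ultimately show ?thesis using that by blast
qed

lemma abs_power_le_one_plus_square_power: "\<bar>y :: real\<bar> ^ n \<le> (1 + y\<^sup>2) ^ n"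
  using zero_le_power2[of "\<bar>y\<bar> - 1"] zero_le_power2[of y]
  by (intro power_mono) (simp_all add: power2_diff)

text \<open>Peetre's inequality; it transfers polynomial decay of the noise density to the output.\<close>
lemma one_plus_square_shift_le:
  fixes y s :: real
  shows "1 + y\<^sup>2 \<le> 2 * ((1 + (y - s)\<^sup>2) * (1 + s\<^sup>2))"
proof -
  have "0 \<le> (y - 2 * s)\<^sup>2" "0 \<le> ((y - s) * s)\<^sup>2" by auto
  moreover have "2 * ((1 + (y - s)\<^sup>2) * (1 + s\<^sup>2)) = 1 + y\<^sup>2 + (y - 2 * s)\<^sup>2 + 1 + 2 * ((y - s) * s)\<^sup>2"
    by (simp add: power2_eq_square algebra_simps)
  ultimately show ?thesis by linarith
qed

text \<open>Completing the square: exponential tilting shifts the mean of a Gaussian. It makes every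
  moment of the lognormal fading finite.\<close>

lemma normal_density_mult_exp:
  assumes "\<sigma> > 0"
  shows "normal_density \<mu> \<sigma> t * exp (a * t) =
    exp (a * \<mu> + a\<^sup>2 * \<sigma>\<^sup>2 / 2) * normal_density (\<mu> + a * \<sigma>\<^sup>2) \<sigma> t"
proof -
  have "- (t - \<mu>)\<^sup>2 / (2 * \<sigma>\<^sup>2) + a * t
    = a * \<mu> + a\<^sup>2 * \<sigma>\<^sup>2 / 2 + - (t - (\<mu> + a * \<sigma>\<^sup>2))\<^sup>2 / (2 * \<sigma>\<^sup>2)"
    using assms by (simp add: field_simps power2_eq_square)
  then show ?thesis
    by (simp add: normal_density_def flip: exp_add)
qed

lemma integrable_normal_density_exp:
  "\<sigma> > 0 \<Longrightarrow> integrable lborel (\<lambda>t. normal_density \<mu> \<sigma> t * exp (a * t))"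
  by (simp add: normal_density_mult_exp)

text \<open>A zero integral would make \<open>f\<close> vanish almost everywhere, impossible as the
  whole line is not a null set. Supplies the strict positivity of \<open>D\<close> and
  \<open>W\<close> in the kernel bounds and of the fading moments.\<close>

lemma integral_pos_lborel:
  fixes f :: "real \<Rightarrow> real"
  assumes f: "integrable lborel f" and pos: "\<And>t. f t > 0"
  shows "(\<integral>t. f t \<partial>lborel) > 0"
proof -
  have "(\<integral>t. f t \<partial>lborel) \<noteq> 0"
  proof
    assume "(\<integral>t. f t \<partial>lborel) = 0"
    then have "AE t in lborel. f t = 0"
      using pos f by (subst (asm) integral_nonneg_eq_0_iff_AE) (auto intro: less_imp_le)
    then have "AE t in lborel::real measure. False"
      using pos by (auto elim!: eventually_mono simp: less_le)
    then show False by (simp add: AE_iff_null null_sets_def)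
  qed
  moreover have "(\<integral>t. f t \<partial>lborel) \<ge> 0"
    using pos by (intro integral_nonneg_AE) (auto intro: less_imp_le)
  ultimately show ?thesis by simp
qed

section \<open>The channel kernel: continuity, two-sided bounds and moments\<close>

locale fading_channel =
  fixes \<kappa> sl sg A :: real
  assumes \<kappa>_pos: "\<kappa> > 0" and sl_pos: "sl > 0" and sg_pos: "sg > 0" and A_pos: "A > 0"
begin

text \<open>Density of the Gaussian exponent of the fading; under it \<open>exp (2 * t)\<close> is
  the lognormal gain.\<close>

abbreviation w :: "real \<Rightarrow> real" where
  "w \<equiv> normal_density (- sl\<^sup>2) sl"

abbreviation noise :: "real \<Rightarrow> real" where
  "noise \<equiv> normal_density 0 sg"

abbreviation K :: "real \<Rightarrow> real \<Rightarrow> real" where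
  "K \<equiv> cond_dens \<kappa> sl sg"

lemma measurable_K [measurable]: "(\<lambda>(x, y). K x y) \<in> borel_measurable (borel \<Otimes>\<^sub>M borel)"
  unfolding cond_dens_def by measurable

lemma noise_le: "noise u \<le> 1 / sqrt (2 * pi * sg\<^sup>2)"
  using sg_pos by (simp add: normal_density_def divide_right_mono)

lemma integrand_le: "norm (w t * noise u) \<le> w t * (1 / sqrt (2 * pi * sg\<^sup>2))"
  using mult_left_mono[OF noise_le, of "w t" u] by (simp add: abs_mult)

lemma integrable_integrand: "integrable lborel (\<lambda>t. w t * noise (y - \<kappa> * exp (2 * t) * x))"
proof (rule Bochner_Integration.integrable_bound)
  show "integrable lborel (\<lambda>t. w t * (1 / sqrt (2 * pi * sg\<^sup>2)))"
    using sl_pos by (intro integrable_mult_left) auto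
  show "AE t in lborel. norm (w t * noise (y - \<kappa> * exp (2 * t) * x)) \<le> norm (w t * (1 / sqrt (2 * pi * sg\<^sup>2)))"
    using order_trans[OF integrand_le abs_ge_self] unfolding real_norm_def by (intro AE_I2)
qed measurable

text \<open>The noise density never exceeds its peak, so \<open>w\<close> times that peak dominates
  the integrand for all x at once and continuity passes through the fading integral.\<close>

lemma continuous_K: "continuous_on UNIV (\<lambda>x. K x y)"
proof (intro continuous_at_imp_continuous_on ballI)
  fix x
  show "isCont (\<lambda>x. K x y) x"
    unfolding continuous_at_sequentially o_def
  proof (intro allI impI)
    fix X assume X: "X \<longlonglongrightarrow> x"
    show "(\<lambda>n. K (X n) y) \<longlonglongrightarrow> K x y"
      unfolding cond_dens_def
    proof (rule integral_dominated_convergence)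
      show "integrable lborel (\<lambda>t. w t * (1 / sqrt (2 * pi * sg\<^sup>2)))"
        using sl_pos by (intro integrable_mult_left) auto
      show "AE t in lborel. (\<lambda>n. w t * noise (y - \<kappa> * exp (2 * t) * X n))
          \<longlonglongrightarrow> w t * noise (y - \<kappa> * exp (2 * t) * x)"
        unfolding normal_density_def[of 0] using X sg_pos
        by (intro AE_I2 tendsto_intros) auto
      show "AE t in lborel. norm (w t * noise (y - \<kappa> * exp (2 * t) * X n)) \<le> w t * (1 / sqrt (2 * pi * sg\<^sup>2))" for n
        by (intro AE_I2 integrand_le)
    qed measurable
  qed
qed

lemma integrable_w_exp_power: "integrable lborel (\<lambda>t. w t * exp (2 * t) ^ j)"
proof -
  have "exp (2 * t) ^ j = exp (2 * real j * t)" for t :: real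
    by (simp flip: exp_of_nat_mult add: mult_ac)
  then show ?thesis
    using integrable_normal_density_exp[OF sl_pos] by simp
qed

text \<open>Expanding the binomial leaves a finite combination of fading moments. The integrand is
  the majorant in t that \<open>noise_shift_bound\<close> produces.\<close>

lemma integrable_w_gain: "integrable lborel (\<lambda>t. w t * (1 + (\<kappa> * exp (2 * t) * A)\<^sup>2) ^ n)"
proof -
  have "w t * (1 + (\<kappa> * exp (2 * t) * A)\<^sup>2) ^ n =
    (\<Sum>j\<le>n. of_nat (n choose j) * (\<kappa> * A) ^ (2 * j) * (w t * exp (2 * t) ^ (2 * j)))" for t
    by (simp add: add.commute[of 1] binomial_ring sum_distrib_left power_mult_distrib mult_ac flip: power_mult)
  then show ?thesis
    by (simp add: integrable_w_exp_power del: power_mult_distrib)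
qed

text \<open>With s the faded signal, Peetre's inequality trades \<open>(1 + y\<^sup>2) ^ n\<close>
  for a power of \<open>1 + (y - s)\<^sup>2\<close>, absorbed by the Gaussian, and a power of
  \<open>1 + s\<^sup>2\<close>, largest at x = A.\<close>

lemma noise_shift_bound:
  obtains C where "C > 0"
    "\<And>x y t. x \<in> {0..A} \<Longrightarrow> noise (y - \<kappa> * exp (2 * t) * x) * (1 + y\<^sup>2) ^ n
       \<le> C * (1 + (\<kappa> * exp (2 * t) * A)\<^sup>2) ^ n"
proof -
  obtain C where C: "C > 0" "\<And>u. noise u * (1 + u\<^sup>2) ^ n \<le> C"
    using normal_density_mult_power_bounded[OF sg_pos] by metis
  have "noise (y - \<kappa> * exp (2 * t) * x) * (1 + y\<^sup>2) ^ n
       \<le> (2 ^ n * C) * (1 + (\<kappa> * exp (2 * t) * A)\<^sup>2) ^ n" if x: "x \<in> {0..A}" for x y t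
  proof -
    define s where "s = \<kappa> * exp (2 * t) * x"
    have s: "0 \<le> s" "s \<le> \<kappa> * exp (2 * t) * A"
      using x \<kappa>_pos by (auto simp: s_def)
    have "noise (y - s) * (1 + y\<^sup>2) ^ n \<le> noise (y - s) * (2 * ((1 + (y - s)\<^sup>2) * (1 + s\<^sup>2))) ^ n"
      by (intro mult_left_mono power_mono one_plus_square_shift_le) auto
    also have "\<dots> = 2 ^ n * (noise (y - s) * (1 + (y - s)\<^sup>2) ^ n) * (1 + s\<^sup>2) ^ n"
      by (simp only: power_mult_distrib) (simp add: mult_ac)
    also have "\<dots> \<le> 2 ^ n * C * (1 + (\<kappa> * exp (2 * t) * A)\<^sup>2) ^ n"
      using s C by (intro mult_mono power_mono add_mono) (auto intro: less_imp_le)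
    finally show ?thesis by (simp add: s_def)
  qed
  with C(1) show ?thesis by (intro that[of "2 ^ n * C"]) auto
qed

text \<open>Averages \<open>noise_shift_bound\<close> over the fading. The order n stays free:
  entropy integrals use 2, while the n-th output moment uses \<open>Suc n\<close>.\<close>

lemma K_upper:
  obtains D where "D > 0" "\<And>x y. x \<in> {0..A} \<Longrightarrow> K x y \<le> D / (1 + y\<^sup>2) ^ n"
proof -
  obtain C where C: "C > 0"
    "\<And>x y t. x \<in> {0..A} \<Longrightarrow> noise (y - \<kappa> * exp (2 * t) * x) * (1 + y\<^sup>2) ^ n
       \<le> C * (1 + (\<kappa> * exp (2 * t) * A)\<^sup>2) ^ n"
    using noise_shift_bound[of n] by metis
  define D where "D = C * (\<integral>t. w t * (1 + (\<kappa> * exp (2 * t) * A)\<^sup>2) ^ n \<partial>lborel)"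
  have "K x y \<le> D / (1 + y\<^sup>2) ^ n" if x: "x \<in> {0..A}" for x y
  proof -
    have "K x y * (1 + y\<^sup>2) ^ n = (\<integral>t. w t * noise (y - \<kappa> * exp (2 * t) * x) * (1 + y\<^sup>2) ^ n \<partial>lborel)"
      by (simp add: cond_dens_def)
    also have "\<dots> \<le> (\<integral>t. C * (w t * (1 + (\<kappa> * exp (2 * t) * A)\<^sup>2) ^ n) \<partial>lborel)"
    proof (rule integral_mono)
      fix t
      show "w t * noise (y - \<kappa> * exp (2 * t) * x) * (1 + y\<^sup>2) ^ n \<le> C * (w t * (1 + (\<kappa> * exp (2 * t) * A)\<^sup>2) ^ n)"
        using mult_left_mono[OF C(2)[OF x, of y t], of "w t"] by (simp add: mult_ac)
    qed (use integrable_integrand integrable_w_gain in auto)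
    finally have "K x y * (1 + y\<^sup>2) ^ n \<le> D" by (simp add: D_def)
    moreover have "(1 + y\<^sup>2) ^ n > 0" by (intro zero_less_power) (simp add: add_pos_nonneg)
    ultimately show ?thesis by (simp add: pos_le_divide_eq)
  qed
  moreover have "D > 0"
    unfolding D_def using C sl_pos
    by (intro mult_pos_pos integral_pos_lborel integrable_w_gain zero_less_power add_pos_nonneg normal_density_pos) auto
  ultimately show ?thesis using that by blast
qed

text \<open>Since \<open>(y - s)\<^sup>2 \<le> 2 * y\<^sup>2 + 2 * s\<^sup>2\<close>, the noise
  density is at least a Gaussian factor in y times a factor in t taken at the largest input A; the
  fading average of the latter is a positive constant \<open>W\<close>.\<close>

lemma K_lower:
  obtains C where "C > 0" "\<And>x y. x \<in> {0..A} \<Longrightarrow> exp (- (C * (1 + y\<^sup>2))) \<le> K x y"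
proof -
  define f where "f t = w t * exp (- (\<kappa> * exp (2 * t) * A)\<^sup>2 / sg\<^sup>2) / sqrt (2 * pi * sg\<^sup>2)" for t
  have f: "integrable lborel f"
  proof (rule Bochner_Integration.integrable_bound)
    show "integrable lborel (\<lambda>t. w t / sqrt (2 * pi * sg\<^sup>2))"
      using sl_pos by auto
    show "AE t in lborel. norm (f t) \<le> norm (w t / sqrt (2 * pi * sg\<^sup>2))"
      unfolding f_def by (intro AE_I2) (auto simp: abs_mult intro!: divide_right_mono mult_left_le)
  qed (unfold f_def, measurable)
  have fpos: "f t > 0" for t
    unfolding f_def using sl_pos sg_pos
    by (intro divide_pos_pos mult_pos_pos normal_density_pos) auto
  define W where "W = (\<integral>t. f t \<partial>lborel)"
  have W: "W > 0" unfolding W_def using f fpos by (rule integral_pos_lborel)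
  \<comment> \<open>The first summand covers the exponent \<open>y\<^sup>2 / sg\<^sup>2\<close>, the
    second a possibly negative \<open>ln W\<close>, because
    \<open>1 + y\<^sup>2 \<ge> 1\<close>.\<close>
  define C where "C = 1 / sg\<^sup>2 + \<bar>ln W\<bar>"
  have "exp (- (C * (1 + y\<^sup>2))) \<le> K x y" if x: "x \<in> {0..A}" for x y
  proof -
    have "- (C * (1 + y\<^sup>2)) \<le> - y\<^sup>2 / sg\<^sup>2 + ln W"
    proof -
      have "C * (1 + y\<^sup>2) = 1 / sg\<^sup>2 + y\<^sup>2 / sg\<^sup>2 + \<bar>ln W\<bar> + \<bar>ln W\<bar> * y\<^sup>2"
        by (simp add: C_def algebra_simps add_divide_distrib)
      moreover have "\<bar>ln W\<bar> * y\<^sup>2 \<ge> 0" "1 / sg\<^sup>2 \<ge> 0" by auto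
      ultimately show ?thesis by linarith
    qed
    then have "exp (- (C * (1 + y\<^sup>2))) \<le> exp (- y\<^sup>2 / sg\<^sup>2 + ln W)" by simp
    also have "\<dots> = (\<integral>t. exp (- y\<^sup>2 / sg\<^sup>2) * f t \<partial>lborel)"
      using W unfolding exp_add by (simp add: W_def)
    also have "\<dots> \<le> K x y"
      unfolding cond_dens_def
    proof (rule integral_mono)
      fix t
      define s where "s = \<kappa> * exp (2 * t) * x"
      have s: "0 \<le> s" "s \<le> \<kappa> * exp (2 * t) * A"
        using x \<kappa>_pos by (auto simp: s_def)
      have "(y - s)\<^sup>2 \<le> 2 * y\<^sup>2 + 2 * s\<^sup>2"
        using zero_le_power2[of "y + s"] by (simp add: power2_eq_square algebra_simps)
      also have "\<dots> \<le> 2 * y\<^sup>2 + 2 * (\<kappa> * exp (2 * t) * A)\<^sup>2"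
        using s by (intro add_left_mono mult_left_mono power_mono) auto
      finally have "- (2 * y\<^sup>2 + 2 * (\<kappa> * exp (2 * t) * A)\<^sup>2) / (2 * sg\<^sup>2) \<le> - (y - s)\<^sup>2 / (2 * sg\<^sup>2)"
        by (intro divide_right_mono) auto
      then have "- y\<^sup>2 / sg\<^sup>2 + - (\<kappa> * exp (2 * t) * A)\<^sup>2 / sg\<^sup>2 \<le> - (y - s)\<^sup>2 / (2 * sg\<^sup>2)"
        using sg_pos by (simp add: field_simps)
      then have "exp (- y\<^sup>2 / sg\<^sup>2) * exp (- (\<kappa> * exp (2 * t) * A)\<^sup>2 / sg\<^sup>2) \<le> exp (- (y - s)\<^sup>2 / (2 * sg\<^sup>2))"
        by (simp flip: exp_add)
      then have "exp (- y\<^sup>2 / sg\<^sup>2) * exp (- (\<kappa> * exp (2 * t) * A)\<^sup>2 / sg\<^sup>2) / sqrt (2 * pi * sg\<^sup>2) \<le> noise (y - s)"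
        by (simp add: normal_density_def divide_right_mono)
      from mult_left_mono[OF this, of "w t"]
      show "exp (- y\<^sup>2 / sg\<^sup>2) * f t \<le> w t * noise (y - \<kappa> * exp (2 * t) * x)"
        by (simp add: f_def s_def mult_ac)
    qed (use f integrable_integrand in auto)
    finally show ?thesis .
  qed
  moreover have "C > 0" using sg_pos by (simp add: C_def add_pos_nonneg)
  ultimately show ?thesis using that by blast
qed

text \<open>Fubini moves the y-integral inside; translating y by the faded signal centres the noise,
  and the binomial theorem then yields a polynomial in x whose coefficients are products of fading
  and noise moments.\<close>

lemma K_moment:
  assumes x: "x \<in> {0..A}"
  shows "(\<integral>y. y ^ n * K x y \<partial>lborel) =
    (\<Sum>j\<le>n. of_nat (n choose j) * \<kappa> ^ j * (\<integral>t. w t * exp (2 * t) ^ j \<partial>lborel)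
        * (\<integral>u. noise u * u ^ (n - j) \<partial>lborel) * x ^ j)"
proof -
  define f where "f t y = y ^ n * (w t * noise (y - \<kappa> * exp (2 * t) * x))" for t y
  \<comment> \<open>Of the \<open>Suc n\<close> powers, n absorb \<open>\<bar>y\<bar> ^ n\<close>
    and the extra one leaves the integrable \<open>1 / (1 + y\<^sup>2)\<close>.\<close>
  obtain C where C: "C > 0"
    "\<And>y t. noise (y - \<kappa> * exp (2 * t) * x) * (1 + y\<^sup>2) ^ Suc n
       \<le> C * (1 + (\<kappa> * exp (2 * t) * A)\<^sup>2) ^ Suc n"
    using noise_shift_bound[of "Suc n"] x by metis
  have int: "integrable (lborel \<Otimes>\<^sub>M lborel) (case_prod f)"
  proof (rule Bochner_Integration.integrable_bound)
    show "integrable (lborel \<Otimes>\<^sub>M lborel)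
       (\<lambda>(t, y). (C * (w t * (1 + (\<kappa> * exp (2 * t) * A)\<^sup>2) ^ Suc n)) * (1 / (1 + y\<^sup>2)))"
      by (intro lborel_pair.integrable_mult_pair integrable_mult_right integrable_w_gain
          integrable_inverse_1_plus_square_lborel)
    show "case_prod f \<in> borel_measurable (lborel \<Otimes>\<^sub>M lborel)"
      unfolding f_def by measurable
    have "\<bar>f t y\<bar> \<le> C * (w t * (1 + (\<kappa> * exp (2 * t) * A)\<^sup>2) ^ Suc n) * (1 / (1 + y\<^sup>2))" for t y
    proof -
      have pos: "1 + y\<^sup>2 > 0" by (simp add: add_pos_nonneg)
      have "\<bar>f t y\<bar> * (1 + y\<^sup>2) \<le> (1 + y\<^sup>2) ^ n * (w t * noise (y - \<kappa> * exp (2 * t) * x)) * (1 + y\<^sup>2)"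
        using pos by (auto simp: f_def abs_mult power_abs intro!: mult_right_mono abs_power_le_one_plus_square_power)
      also have "\<dots> = w t * (noise (y - \<kappa> * exp (2 * t) * x) * (1 + y\<^sup>2) ^ Suc n)"
        by simp
      also have "\<dots> \<le> w t * (C * (1 + (\<kappa> * exp (2 * t) * A)\<^sup>2) ^ Suc n)"
        by (intro mult_left_mono C) auto
      finally show ?thesis using pos by (simp add: field_simps)
    qed
    note bound = this
    show "AE z in lborel \<Otimes>\<^sub>M lborel. norm (case_prod f z)
       \<le> norm (case z of (t, y) \<Rightarrow> C * (w t * (1 + (\<kappa> * exp (2 * t) * A)\<^sup>2) ^ Suc n) * (1 / (1 + y\<^sup>2)))"
      unfolding real_norm_def case_prod_beta
      by (intro AE_I2 order_trans[OF _ abs_ge_self] bound)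
  qed
  have inner: "(\<integral>y. f t y \<partial>lborel) = (\<Sum>j\<le>n. of_nat (n choose j) * \<kappa> ^ j * (w t * exp (2 * t) ^ j)
        * (\<integral>u. noise u * u ^ (n - j) \<partial>lborel) * x ^ j)" for t
  proof -
    define s where "s = \<kappa> * exp (2 * t) * x"
    have "(\<integral>y. f t y \<partial>lborel) = (\<integral>u. f t (s + u) \<partial>lborel)"
      using lborel_integral_real_affine[of 1 "f t" s] by simp
    also have "\<dots> = (\<integral>u. (\<Sum>j\<le>n. of_nat (n choose j) * s ^ j * w t * (noise u * u ^ (n - j))) \<partial>lborel)"
      unfolding f_def s_def[symmetric]
      by (simp add: binomial_ring sum_distrib_left sum_distrib_right mult_ac)
    also have "\<dots> = (\<Sum>j\<le>n. of_nat (n choose j) * s ^ j * w t * (\<integral>u. noise u * u ^ (n - j) \<partial>lborel))"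
      using integrable_normal_moment[OF sg_pos, of 0] by (subst Bochner_Integration.integral_sum) auto
    also have "\<dots> = (\<Sum>j\<le>n. of_nat (n choose j) * \<kappa> ^ j * (w t * exp (2 * t) ^ j)
        * (\<integral>u. noise u * u ^ (n - j) \<partial>lborel) * x ^ j)"
      by (simp add: s_def power_mult_distrib mult_ac)
    finally show ?thesis .
  qed
  have "(\<integral>y. y ^ n * K x y \<partial>lborel) = (\<integral>y. \<integral>t. f t y \<partial>lborel \<partial>lborel)"
    by (simp add: cond_dens_def f_def)
  also have "\<dots> = (\<integral>t. \<integral>y. f t y \<partial>lborel \<partial>lborel)"
    by (rule lborel_pair.Fubini_integral[OF int])
  also have "\<dots> = (\<Sum>j\<le>n. of_nat (n choose j) * \<kappa> ^ j * (\<integral>t. w t * exp (2 * t) ^ j \<partial>lborel)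
        * (\<integral>u. noise u * u ^ (n - j) \<partial>lborel) * x ^ j)"
    unfolding inner
  proof (subst Bochner_Integration.integral_sum)
    show "integrable lborel (\<lambda>t. of_nat (n choose j) * \<kappa> ^ j * (w t * exp (2 * t) ^ j)
        * (\<integral>u. noise u * u ^ (n - j) \<partial>lborel) * x ^ j)" for j
      by (intro integrable_mult_left integrable_mult_right integrable_w_exp_power)
  qed simp
  finally show ?thesis .
qed

end

section \<open>Convexity of t log t, midpoints of laws, and the moment problem\<close>

lemma xlnx_midpoint:
  fixes p q :: real
  assumes p: "p > 0" and q: "q > 0"
  shows "2 * ((p + q) / 2 * ln ((p + q) / 2)) \<le> p * ln p + q * ln q"
    and "2 * ((p + q) / 2 * ln ((p + q) / 2)) = p * ln p + q * ln q \<Longrightarrow> p = q"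
proof -
  define m where "m = (p + q) / 2"
  have m: "m > 0" and sum: "p + q = 2 * m" using p q by (simp_all add: m_def)
  \<comment> \<open>This is \<open>ln z \<le> z - 1\<close> at \<open>z = m / r\<close>. Added for r
    = p and r = q, the right-hand sides cancel since \<open>p + q = 2 * m\<close>.\<close>
  have le: "r * ln m - r * ln r \<le> m - r" if "r > 0" for r
  proof -
    have "r * ln (m / r) \<le> r * (m / r - 1)"
      using that m by (intro mult_left_mono ln_le_minus_one) auto
    also have "\<dots> = m - r" using that by (simp add: field_simps)
    finally show ?thesis using that m by (simp add: ln_div right_diff_distrib)
  qed
  have eq: "r = m" if "r > 0" "r * ln m - r * ln r = m - r" for r
  proof -
    have "ln (m / r) = m / r - 1" using that m by (simp add: ln_div field_simps)
    then have "m / r = 1" using that m by (intro ln_eq_minus_one) auto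
    then show ?thesis using that by simp
  qed
  have split: "2 * (m * ln m) = p * ln m + q * ln m"
    using sum by (simp add: m_def algebra_simps)
  show "2 * ((p + q) / 2 * ln ((p + q) / 2)) \<le> p * ln p + q * ln q"
    unfolding m_def[symmetric] using le[OF p] le[OF q] split sum by linarith
  \<comment> \<open>Equality of the sums makes both instances of \<open>le\<close> tight, and
    \<open>ln z = z - 1\<close> only at z = 1, so p and q both equal m.\<close>
  show "p = q" if "2 * ((p + q) / 2 * ln ((p + q) / 2)) = p * ln p + q * ln q"
    using that le[OF p] le[OF q] split sum eq[OF p] eq[OF q] unfolding m_def[symmetric] by linarith
qed

text \<open>The midpoint of two laws, encoded as a fair coin choosing between them so that the
  monadic bind yields a probability measure and its integral formula.\<close>

definition mixture :: "real measure \<Rightarrow> real measure \<Rightarrow> real measure" where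
  "mixture F G = measure_pmf (bernoulli_pmf (1 / 2)) \<bind> (\<lambda>b. if b then F else G)"

context
  fixes F G :: "real measure"
  assumes F: "real_distribution F" and G: "real_distribution G"
begin

interpretation F: real_distribution F by (rule F)
interpretation G: real_distribution G by (rule G)

lemma measurable_mixture_kernel:
  "(\<lambda>b. if b then F else G) \<in> measurable (measure_pmf (bernoulli_pmf (1 / 2))) (subprob_algebra borel)"
  by (auto simp: measurable_def space_subprob_algebra F.subprob_space_axioms G.subprob_space_axioms)

lemma real_distribution_mixture: "real_distribution (mixture F G)"
proof (intro real_distribution.intro real_distribution_axioms.intro)
  show "prob_space (mixture F G)"
    unfolding mixture_def
    by (intro measure_pmf.prob_space_bind[OF _ measurable_mixture_kernel])
       (auto simp: F.prob_space_axioms G.prob_space_axioms)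
  show "sets (mixture F G) = sets borel"
    unfolding mixture_def by (rule sets_bind) auto
qed

lemma integral_mixture:
  fixes f :: "real \<Rightarrow> real"
  assumes f: "f \<in> borel_measurable borel" and bound: "\<And>x. \<bar>f x\<bar> \<le> B"
  shows "(\<integral>x. f x \<partial>mixture F G) = ((\<integral>x. f x \<partial>F) + (\<integral>x. f x \<partial>G)) / 2"
proof -
  have "(\<integral>x. f x \<partial>mixture F G) =
      (\<integral>b. (\<integral>x. f x \<partial>(if b then F else G)) \<partial>measure_pmf (bernoulli_pmf (1 / 2)))"
    unfolding mixture_def
    by (rule integral_bind[OF f bound measurable_mixture_kernel, where B' = 1])
       (auto simp: measure_pmf.finite_measure_axioms F.emeasure_space_1 G.emeasure_space_1
         simp flip: F.space_eq_univ G.space_eq_univ)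
  then show ?thesis
    by (subst (asm) integral_measure_pmf[where A = UNIV]) (auto simp: UNIV_bool)
qed

end

text \<open>On a bounded support the Taylor polynomial of the characteristic function, built from
  moments alone, has error at most \<open>2 * ((\<bar>t\<bar> * A) ^ n / fact n)\<close>. These are
  terms of an exponential series and tend to 0, so the characteristic functions coincide and Levy's
  uniqueness theorem applies.\<close>

lemma moments_determine_distribution:
  fixes F G :: "real measure"
  assumes F: "real_distribution F" and G: "real_distribution G"
    and suppF: "AE x in F. \<bar>x\<bar> \<le> A" and suppG: "AE x in G. \<bar>x\<bar> \<le> A"
    and moments: "\<And>n. (\<integral>x. x ^ n \<partial>F) = (\<integral>x. x ^ n \<partial>G)"
  shows "F = G"
proof (rule Levy_uniqueness[OF F G], rule ext)
  fix t
  have approx: "cmod (char M t - (\<Sum>k\<le>n. ((\<i> * t) ^ k / fact k) * (\<integral>x. x ^ k \<partial>M))) \<le> 2 * ((\<bar>t\<bar> * A) ^ n / fact n)"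
    if M: "real_distribution M" and supp: "AE x in M. \<bar>x\<bar> \<le> A" for M n
  proof -
    interpret real_distribution M by (rule M)
    have bound: "AE x in M. \<bar>x ^ k\<bar> \<le> A ^ k" for k
      using supp by eventually_elim (auto simp: power_abs intro: power_mono)
    have int: "integrable M (\<lambda>x. x ^ k)" for k
      using bound[of k] by (intro integrable_const_bound[where B = "A ^ k"]) auto
    have "expectation (\<lambda>x. \<bar>x\<bar> ^ n) \<le> A ^ n"
      using bound[of n] integrable_abs[OF int[of n]] by (intro integral_le_const) (auto simp: power_abs)
    then have "(2 * \<bar>t\<bar> ^ n / fact n) * expectation (\<lambda>x. \<bar>x\<bar> ^ n) \<le> (2 * \<bar>t\<bar> ^ n / fact n) * A ^ n"
      by (intro mult_left_mono) auto
    then show ?thesis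
      using char_approx1[of n t, OF int] by (simp add: power_mult_distrib)
  qed
  have "cmod (char F t - char G t) \<le> 4 * ((\<bar>t\<bar> * A) ^ n / fact n)" for n
  proof -
    define s where "s = (\<Sum>k\<le>n. ((\<i> * t) ^ k / fact k) * (\<integral>x. x ^ k \<partial>F))"
    have "cmod (char F t - s) \<le> 2 * ((\<bar>t\<bar> * A) ^ n / fact n)"
      unfolding s_def by (rule approx[OF F suppF])
    moreover have "cmod (char G t - s) \<le> 2 * ((\<bar>t\<bar> * A) ^ n / fact n)"
      unfolding s_def moments by (rule approx[OF G suppG])
    moreover have "cmod (char F t - char G t) \<le> cmod (char F t - s) + cmod (char G t - s)"
      using norm_triangle_ineq4[of "char F t - s" "char G t - s"] by simp
    ultimately show ?thesis by linarith
  qed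
  moreover have "(\<lambda>n. 4 * ((\<bar>t\<bar> * A) ^ n / fact n)) \<longlonglongrightarrow> 4 * 0"
    using summable_LIMSEQ_zero[OF summable_exp_generic[of "\<bar>t\<bar> * A"]]
    by (intro tendsto_mult tendsto_const) (simp add: divide_inverse mult.commute)
  ultimately have "cmod (char F t - char G t) \<le> 4 * 0"
    by (intro LIMSEQ_le_const) auto
  then show "char F t = char G t" by simp
qed

section \<open>Entropy integrals and the decomposition of mutual information\<close>

locale fading_channel_bounds = fading_channel +
  fixes D C :: real
  assumes D_pos: "D > 0" and C_pos: "C > 0"
    and K_le: "x \<in> {0..A} \<Longrightarrow> K x y \<le> D / (1 + y\<^sup>2)\<^sup>2"
    and K_ge: "x \<in> {0..A} \<Longrightarrow> exp (- (C * (1 + y\<^sup>2))) \<le> K x y"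
begin

abbreviation out :: "real measure \<Rightarrow> real \<Rightarrow> real" where
  "out \<equiv> out_dens \<kappa> sl sg"

abbreviation info :: "real measure \<Rightarrow> real" where
  "info \<equiv> mutual_info \<kappa> sl sg"

text \<open>The laws on [0, A] before the power and harvesting constraints; mutual information is
  analysed on this larger set.\<close>

definition inputs :: "real measure set" where
  "inputs = {F. real_distribution F \<and> measure F {0..A} = 1}"

text \<open>Retraction of the line onto [0, A]. Composing with it makes functions controlled only on
  [0, A] globally bounded or continuous, without changing their integrals against
  \<open>inputs\<close>.\<close>

definition clip :: "real \<Rightarrow> real" where
  "clip x = max 0 (min A x)"

lemma clip_in: "clip x \<in> {0..A}" and clip_id: "x \<in> {0..A} \<Longrightarrow> clip x = x"
  using A_pos by (auto simp: clip_def)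

lemma continuous_clip: "continuous_on UNIV clip"
  unfolding clip_def by (intro continuous_intros)

lemma measurable_clip [measurable]: "clip \<in> borel_measurable borel"
  using continuous_clip by (rule borel_measurable_continuous_onI)

text \<open>The common envelope of kernel and output densities: its bounds do not involve x, so they
  survive averaging over the input.\<close>

definition admissible :: "real \<Rightarrow> real \<Rightarrow> bool" where
  "admissible y p \<longleftrightarrow> exp (- (C * (1 + y\<^sup>2))) \<le> p \<and> p \<le> D / (1 + y\<^sup>2)\<^sup>2"

definition E :: real where "E = D * (C + \<bar>ln D\<bar>)"

lemma admissible_K: "x \<in> {0..A} \<Longrightarrow> admissible y (K x y)"
  by (simp add: admissible_def K_le K_ge)

lemma admissible_pos: "admissible y p \<Longrightarrow> p > 0"
  unfolding admissible_def by (rule less_le_trans[OF exp_gt_zero]) auto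

text \<open>The lower envelope lets \<open>\<bar>ln p\<bar>\<close> grow at most like
  \<open>1 + y\<^sup>2\<close>, while q decays like its inverse square. Keeping p and q separate
  covers the cross term of kernel and output as well.\<close>

lemma admissible_mult_ln:
  assumes p: "admissible y p" and q: "admissible y q"
  shows "\<bar>q * ln p\<bar> \<le> E * (1 / (1 + y\<^sup>2))"
proof -
  have y: "1 + y\<^sup>2 \<ge> 1" by simp
  have ppos: "p > 0" and qpos: "q > 0" using p q admissible_pos by auto
  have "- (C * (1 + y\<^sup>2)) \<le> ln p"
    using p ppos by (simp add: admissible_def ln_ge_iff)
  moreover have "ln p \<le> \<bar>ln D\<bar>"
  proof -
    have "D / (1 + y\<^sup>2)\<^sup>2 \<le> D / 1"
      using y D_pos by (intro divide_left_mono one_le_power mult_pos_pos zero_less_power) linarith+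
    then have "p \<le> D" using p by (simp add: admissible_def)
    then have "ln p \<le> ln D" using ppos by simp
    then show ?thesis by linarith
  qed
  moreover have "\<bar>ln D\<bar> \<le> \<bar>ln D\<bar> * (1 + y\<^sup>2)" "0 \<le> C * (1 + y\<^sup>2)"
    using C_pos by (auto simp: algebra_simps intro!: mult_nonneg_nonneg add_nonneg_nonneg)
  ultimately have ln: "\<bar>ln p\<bar> \<le> (C + \<bar>ln D\<bar>) * (1 + y\<^sup>2)"
    unfolding distrib_right by linarith
  have "\<bar>q * ln p\<bar> = q * \<bar>ln p\<bar>" using qpos by (simp add: abs_mult)
  also have "\<dots> \<le> D / (1 + y\<^sup>2)\<^sup>2 * ((C + \<bar>ln D\<bar>) * (1 + y\<^sup>2))"
    using q qpos D_pos ln by (intro mult_mono) (auto simp: admissible_def)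
  also have "\<dots> = E * (1 / (1 + y\<^sup>2))"
    using y by (simp add: E_def power2_eq_square)
  finally show ?thesis .
qed

lemma integrable_dominating: "integrable lborel (\<lambda>y. E * (1 / (1 + y\<^sup>2)))"
  by (intro integrable_mult_right integrable_inverse_1_plus_square_lborel)

lemma integrable_admissible_mult_ln:
  assumes [measurable]: "p \<in> borel_measurable borel" "q \<in> borel_measurable borel"
    and "\<And>y. admissible y (p y)" "\<And>y. admissible y (q y)"
  shows "integrable lborel (\<lambda>y. q y * ln (p y))"
proof (rule Bochner_Integration.integrable_bound[OF integrable_dominating])
  show "AE y in lborel. norm (q y * ln (p y)) \<le> norm (E * (1 / (1 + y\<^sup>2)))"
    unfolding real_norm_def
    by (intro AE_I2 order_trans[OF admissible_mult_ln abs_ge_self] assms)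
qed measurable

definition L :: real where "L = (\<integral>y. E * (1 / (1 + y\<^sup>2)) \<partial>lborel)"

lemma abs_integral_admissible_mult_ln:
  assumes "p \<in> borel_measurable borel" "q \<in> borel_measurable borel"
    and "\<And>y. admissible y (p y)" "\<And>y. admissible y (q y)"
  shows "\<bar>\<integral>y. q y * ln (p y) \<partial>lborel\<bar> \<le> L"
proof -
  have "\<bar>\<integral>y. q y * ln (p y) \<partial>lborel\<bar> \<le> (\<integral>y. \<bar>q y * ln (p y)\<bar> \<partial>lborel)"
    by (rule integral_abs_bound)
  also have "\<dots> \<le> L"
    unfolding L_def using assms
    by (intro integral_mono integrable_abs integrable_admissible_mult_ln integrable_dominating admissible_mult_ln) auto
  finally show ?thesis .
qed

lemma inputs_real_distribution: "F \<in> inputs \<Longrightarrow> real_distribution F"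
  by (simp add: inputs_def)

lemma AE_inputs:
  assumes "F \<in> inputs"
  shows "AE x in F. x \<in> {0..A}"
proof -
  interpret real_distribution F using assms by (rule inputs_real_distribution)
  show ?thesis using assms by (intro AE_prob_1) (simp add: inputs_def)
qed

lemma integral_clip:
  fixes g :: "real \<Rightarrow> real"
  assumes F: "F \<in> inputs" and [measurable]: "g \<in> borel_measurable borel"
  shows "(\<integral>x. g x \<partial>F) = (\<integral>x. g (clip x) \<partial>F)"
proof -
  interpret real_distribution F using F by (rule inputs_real_distribution)
  show ?thesis
    using AE_inputs[OF F] by (intro integral_cong_AE) (auto simp: clip_id)
qed

lemma integrable_inputs:
  fixes g :: "real \<Rightarrow> real"
  assumes F: "F \<in> inputs" and [measurable]: "g \<in> borel_measurable borel"
    and B: "\<And>x. x \<in> {0..A} \<Longrightarrow> \<bar>g x\<bar> \<le> B"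
  shows "integrable F g"
proof -
  interpret real_distribution F using F by (rule inputs_real_distribution)
  show ?thesis
    using AE_inputs[OF F] B by (intro integrable_const_bound[where B = B]) auto
qed

lemma measurable_K1 [measurable]: "(\<lambda>x. K x y) \<in> borel_measurable borel"
  and measurable_K2 [measurable]: "K x \<in> borel_measurable borel"
  unfolding cond_dens_def by measurable

lemma integrable_K:
  assumes F: "F \<in> inputs"
  shows "integrable F (\<lambda>x. K x y)"
  using admissible_K[of _ y] admissible_pos[of y]
  by (intro integrable_inputs[OF F, where B = "D / (1 + y\<^sup>2)\<^sup>2"])
     (auto simp: admissible_def abs_of_pos)

lemma measurable_out:
  assumes F: "F \<in> inputs"
  shows "out F \<in> borel_measurable borel"
proof -
  interpret real_distribution F using F by (rule inputs_real_distribution)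
  show ?thesis unfolding out_dens_def by measurable
qed

lemma admissible_out:
  assumes F: "F \<in> inputs"
  shows "admissible y (out F y)"
proof -
  interpret real_distribution F using F by (rule inputs_real_distribution)
  have AE: "AE x in F. admissible y (K x y)"
    using AE_inputs[OF F] by eventually_elim (rule admissible_K)
  show ?thesis
    unfolding admissible_def out_dens_def
    using AE integrable_K[OF F, of y]
    by (intro conjI integral_ge_const integral_le_const) (auto simp: admissible_def)
qed

text \<open>For inputs in [0, A], the negative differential entropy, in nats, of the output given
  the input x.\<close>

definition self_info :: "real \<Rightarrow> real" where
  "self_info x = (\<integral>y. K x y * ln (K x y) \<partial>lborel)"

lemma measurable_self_info [measurable]: "self_info \<in> borel_measurable borel"
  unfolding self_info_def by measurable

lemma self_info_bound: "x \<in> {0..A} \<Longrightarrow> \<bar>self_info x\<bar> \<le> L"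
  unfolding self_info_def by (intro abs_integral_admissible_mult_ln measurable_K2 admissible_K)

lemma continuous_self_info: "continuous_on {0..A} self_info"
  unfolding continuous_on_sequentially
proof (intro allI ballI impI)
  fix X x assume x: "x \<in> {0..A}" and X: "(\<forall>n. X n \<in> {0..A}) \<and> X \<longlonglongrightarrow> x"
  show "(self_info \<circ> X) \<longlonglongrightarrow> self_info x"
    unfolding self_info_def o_def
  proof (rule integral_dominated_convergence[OF _ _ integrable_dominating])
    show "AE y in lborel. (\<lambda>n. K (X n) y * ln (K (X n) y)) \<longlonglongrightarrow> K x y * ln (K x y)"
    proof (rule AE_I2)
      fix y
      have "(\<lambda>n. K (X n) y) \<longlonglongrightarrow> K x y"
        using continuous_K[of y] X by (auto simp: continuous_on_sequentially o_def)
      then show "(\<lambda>n. K (X n) y * ln (K (X n) y)) \<longlonglongrightarrow> K x y * ln (K x y)"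
        using admissible_pos[OF admissible_K[OF x, of y]] by (intro tendsto_intros) auto
    qed
    show "AE y in lborel. norm (K (X n) y * ln (K (X n) y)) \<le> E * (1 / (1 + y\<^sup>2))" for n
      unfolding real_norm_def using X by (intro AE_I2 admissible_mult_ln admissible_K) auto
  qed measurable
qed

lemma Fubini_inputs:
  assumes F: "F \<in> inputs" and [measurable]: "g \<in> borel_measurable borel"
    and h: "integrable lborel h"
    and bound: "\<And>x y. x \<in> {0..A} \<Longrightarrow> \<bar>K x y * g y\<bar> \<le> h y"
  shows "(\<integral>x. (\<integral>y. K x y * g y \<partial>lborel) \<partial>F) = (\<integral>y. out F y * g y \<partial>lborel)"
    and "integrable F (\<lambda>x. \<integral>y. K x y * g y \<partial>lborel)"
proof -
  interpret real_distribution F using F by (rule inputs_real_distribution)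
  interpret pair_sigma_finite F lborel ..
  \<comment> \<open>Clipping turns the bound, given only for x in [0, A], into one valid everywhere
    on the product space; the integrals over \<open>F\<close> stay the same.\<close>
  define f where "f x y = K (clip x) y * g y" for x y
  have [measurable]: "case_prod f \<in> borel_measurable (borel \<Otimes>\<^sub>M borel)"
    unfolding f_def by measurable
  have int: "integrable (F \<Otimes>\<^sub>M lborel) (case_prod f)"
  proof (rule Bochner_Integration.integrable_bound)
    show "integrable (F \<Otimes>\<^sub>M lborel) (\<lambda>(x, y). 1 * h y)"
      by (intro integrable_mult_pair h integrable_const)
    show "AE z in F \<Otimes>\<^sub>M lborel. norm (case_prod f z) \<le> norm (case z of (x, y) \<Rightarrow> 1 * h y)"
      unfolding real_norm_def case_prod_beta mult_1 f_def
      by (intro AE_I2 order_trans[OF bound abs_ge_self] clip_in)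
  qed measurable
  have AE: "AE x in F. (\<integral>y. f x y \<partial>lborel) = (\<integral>y. K x y * g y \<partial>lborel)"
    using AE_inputs[OF F] by eventually_elim (simp add: f_def clip_id)
  have "(\<integral>x. (\<integral>y. K x y * g y \<partial>lborel) \<partial>F) = (\<integral>x. (\<integral>y. f x y \<partial>lborel) \<partial>F)"
    using AE by (intro integral_cong_AE) (auto simp: f_def)
  also have "\<dots> = (\<integral>y. (\<integral>x. f x y \<partial>F) \<partial>lborel)"
    using int by (rule Fubini_integral[symmetric])
  also have "\<dots> = (\<integral>y. out F y * g y \<partial>lborel)"
    using integral_clip[OF F measurable_K1] by (simp add: f_def out_dens_def)
  finally show "(\<integral>x. (\<integral>y. K x y * g y \<partial>lborel) \<partial>F) = (\<integral>y. out F y * g y \<partial>lborel)" .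
  show "integrable F (\<lambda>x. \<integral>y. K x y * g y \<partial>lborel)"
    using integrable_fst[OF int] AE
    by (subst integrable_cong_AE[where g = "\<lambda>x. \<integral>y. f x y \<partial>lborel"]) (auto simp: eq_commute)
qed

text \<open>The logarithm of the quotient splits into two separately integrable terms, and Fubini
  turns the cross term into an output entropy integral. The first part is linear in
  \<open>F\<close>, so all nonlinearity sits in \<open>out F\<close>; \<open>ln 2\<close> converts
  nats to bits.\<close>

lemma info_eq:
  assumes F: "F \<in> inputs"
  shows "info F = ((\<integral>x. self_info x \<partial>F) - (\<integral>y. out F y * ln (out F y) \<partial>lborel)) / ln 2"
proof -
  interpret real_distribution F using F by (rule inputs_real_distribution)
  note [measurable] = measurable_out[OF F]
  define c where "c x = (\<integral>y. K x y * ln (out F y) \<partial>lborel)" for x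
  have [measurable]: "c \<in> borel_measurable borel" unfolding c_def by measurable
  have bound: "\<bar>K x y * ln (out F y)\<bar> \<le> E * (1 / (1 + y\<^sup>2))" if "x \<in> {0..A}" for x y
    using that by (intro admissible_mult_ln admissible_K admissible_out F)
  have c: "(\<integral>x. c x \<partial>F) = (\<integral>y. out F y * ln (out F y) \<partial>lborel)" "integrable F c"
    using Fubini_inputs[OF F _ integrable_dominating bound] unfolding c_def by auto
  have dens: "info_dens \<kappa> sl sg F x = (self_info x - c x) / ln 2" if x: "x \<in> {0..A}" for x
  proof -
    have "K x y * log 2 (K x y / out F y) = (K x y * ln (K x y) - K x y * ln (out F y)) / ln 2" for y
      using admissible_pos[OF admissible_K[OF x, of y]] admissible_pos[OF admissible_out[OF F, of y]]
      by (simp add: log_def ln_div field_simps)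
    then show ?thesis
      unfolding info_dens_def self_info_def c_def using x F
      by (simp add: Bochner_Integration.integral_diff integrable_admissible_mult_ln measurable_K2
          admissible_K admissible_out measurable_out)
  qed
  have "info_dens \<kappa> sl sg F \<in> borel_measurable borel"
    unfolding info_dens_def by measurable
  moreover have "AE x in F. info_dens \<kappa> sl sg F x = (self_info x - c x) / ln 2"
    using AE_inputs[OF F] by eventually_elim (rule dens)
  ultimately have "info F = (\<integral>x. (self_info x - c x) / ln 2 \<partial>F)"
    unfolding mutual_info_def by (intro integral_cong_AE) auto
  also have "\<dots> = ((\<integral>x. self_info x \<partial>F) - (\<integral>x. c x \<partial>F)) / ln 2"
    using c(2) integrable_inputs[OF F measurable_self_info self_info_bound] by simp
  finally show ?thesis by (simp add: c)
qed

end

section \<open>Weak continuity of mutual information and compactness of the inputs\<close>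

context fading_channel_bounds
begin

text \<open>Weak convergence tests against bounded continuous functions on the whole line;
  \<open>g\<close> composed with \<open>clip\<close> is one, with the same integrals.\<close>

lemma integral_weak_conv:
  fixes g :: "real \<Rightarrow> real"
  assumes Fn: "\<And>n. Fn n \<in> inputs" and F: "F \<in> inputs" and conv: "weak_conv_m Fn F"
    and g: "continuous_on {0..A} g" and meas: "g \<in> borel_measurable borel"
  shows "(\<lambda>n. \<integral>x. g x \<partial>Fn n) \<longlonglongrightarrow> (\<integral>x. g x \<partial>F)"
proof -
  have "bounded (g ` {0..A})"
    by (intro compact_imp_bounded compact_continuous_image g compact_Icc)
  then obtain B where B: "\<And>x. x \<in> {0..A} \<Longrightarrow> norm (g x) \<le> B"
    unfolding bounded_iff by blast
  have cont: "continuous_on UNIV (\<lambda>x. g (clip x))"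
    by (rule continuous_on_compose2[OF g continuous_clip]) (use clip_in in auto)
  have "(\<lambda>n. \<integral>x. g (clip x) \<partial>Fn n) \<longlonglongrightarrow> (\<integral>x. g (clip x) \<partial>F)"
  proof (rule weak_conv_imp_integral_bdd_continuous_conv[OF _ _ conv])
    show "isCont (\<lambda>x. g (clip x)) x" for x
      using cont by (simp add: continuous_on_eq_continuous_at)
    show "norm (g (clip x)) \<le> B" for x
      by (intro B clip_in)
  qed (use Fn F in \<open>auto intro: inputs_real_distribution\<close>)
  then show ?thesis
    using integral_clip[OF Fn meas] integral_clip[OF F meas] by simp
qed

lemma inputs_closed:
  assumes Fn: "\<And>n. Fn n \<in> inputs" and F: "real_distribution F" and conv: "weak_conv_m Fn F"
  shows "F \<in> inputs"
proof -
  interpret real_distribution F by (rule F)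
  \<comment> \<open>The distance to [0, A] capped at 1: a bounded continuous test function whose
    zero set is exactly [0, A].\<close>
  define g where "g x = min 1 \<bar>x - clip x\<bar>" for x
  have cont: "continuous_on UNIV g"
    unfolding g_def by (intro continuous_intros continuous_clip)
  have meas: "g \<in> borel_measurable borel"
    using cont by (rule borel_measurable_continuous_onI)
  have "(\<lambda>n. \<integral>x. g x \<partial>Fn n) \<longlonglongrightarrow> (\<integral>x. g x \<partial>F)"
  proof (rule weak_conv_imp_integral_bdd_continuous_conv[OF _ F conv, where B = 1])
    show "isCont g x" for x
      using cont by (simp add: continuous_on_eq_continuous_at)
    show "norm (g x) \<le> 1" for x by (simp add: g_def)
  qed (use Fn in \<open>auto intro: inputs_real_distribution\<close>)
  moreover have "(\<integral>x. g x \<partial>Fn n) = 0" for n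
    using integral_clip[OF Fn meas, of n] by (simp add: g_def clip_id[OF clip_in])
  ultimately have "(\<integral>x. g x \<partial>F) = 0"
    by (simp add: LIMSEQ_const_iff)
  moreover have "integrable F g"
    using meas by (intro integrable_const_bound[where B = 1]) (auto simp: g_def)
  ultimately have "AE x in F. g x = 0"
    by (subst (asm) integral_nonneg_eq_0_iff_AE) (auto simp: g_def)
  then have "AE x in F. x \<in> {0..A}"
  proof eventually_elim
    case (elim x)
    then have "x = clip x" by (simp add: g_def min_def split: if_splits)
    then show ?case using clip_in[of x] by simp
  qed
  then show ?thesis
    by (subst (asm) AE_in_set_eq_1) (auto simp: inputs_def F)
qed

text \<open>Continuity of the kernel in x gives pointwise convergence of output densities, and the
  common majorant carries it through the entropy integral; the linear part converges because
  \<open>self_info\<close> is continuous on [0, A].\<close>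

lemma info_weak_conv:
  assumes Fn: "\<And>n. Fn n \<in> inputs" and F: "F \<in> inputs" and conv: "weak_conv_m Fn F"
  shows "(\<lambda>n. info (Fn n)) \<longlonglongrightarrow> info F"
proof -
  have out: "(\<lambda>n. out (Fn n) y) \<longlonglongrightarrow> out F y" for y
    unfolding out_dens_def
    by (intro integral_weak_conv[OF Fn F conv] measurable_K1 continuous_on_subset[OF continuous_K]) auto
  have "(\<lambda>n. \<integral>y. out (Fn n) y * ln (out (Fn n) y) \<partial>lborel) \<longlonglongrightarrow> (\<integral>y. out F y * ln (out F y) \<partial>lborel)"
  proof (rule integral_dominated_convergence[OF _ _ integrable_dominating])
    show "AE y in lborel. (\<lambda>n. out (Fn n) y * ln (out (Fn n) y)) \<longlonglongrightarrow> out F y * ln (out F y)"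
    proof (rule AE_I2)
      show "(\<lambda>n. out (Fn n) y * ln (out (Fn n) y)) \<longlonglongrightarrow> out F y * ln (out F y)" for y
        using admissible_pos[OF admissible_out[OF F, of y]] by (intro tendsto_intros out) auto
    qed
    show "AE y in lborel. norm (out (Fn n) y * ln (out (Fn n) y)) \<le> E * (1 / (1 + y\<^sup>2))" for n
      unfolding real_norm_def using Fn by (intro AE_I2 admissible_mult_ln admissible_out)
  qed (use measurable_out[OF F] measurable_out[OF Fn] in measurable)
  then show ?thesis
    unfolding info_eq[OF F] info_eq[OF Fn]
    by (intro tendsto_intros integral_weak_conv[OF Fn F conv] continuous_self_info measurable_self_info) auto
qed

text \<open>Each of the two terms of \<open>info_eq\<close> contributes at most \<open>L\<close>;
  this keeps the supremum finite.\<close>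

lemma info_le:
  assumes F: "F \<in> inputs"
  shows "info F \<le> 2 * L / ln 2"
proof -
  interpret real_distribution F using F by (rule inputs_real_distribution)
  have "AE x in F. self_info x \<le> L"
    using AE_inputs[OF F] by eventually_elim (use self_info_bound in fastforce)
  then have "(\<integral>x. self_info x \<partial>F) \<le> L"
    using integrable_inputs[OF F measurable_self_info self_info_bound] by (intro integral_le_const)
  moreover have "\<bar>\<integral>y. out F y * ln (out F y) \<partial>lborel\<bar> \<le> L"
    by (intro abs_integral_admissible_mult_ln measurable_out admissible_out F)
  ultimately have "(\<integral>x. self_info x \<partial>F) - (\<integral>y. out F y * ln (out F y) \<partial>lborel) \<le> 2 * L"
    by linarith
  then show ?thesis
    unfolding info_eq[OF F] by (intro divide_right_mono) auto
qed

text \<open>The common bounded support makes every sequence tight, so a subsequence converges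
  weakly, and the limit keeps the support.\<close>

lemma inputs_seq_compact:
  assumes Fn: "\<And>n. Fn n \<in> inputs"
  obtains r F where "strict_mono (r :: nat \<Rightarrow> nat)" "F \<in> inputs" "weak_conv_m (Fn \<circ> r) F"
proof -
  have "tight Fn"
    unfolding tight_def
  proof (intro conjI allI impI)
    show "real_distribution (Fn n)" for n using Fn by (rule inputs_real_distribution)
    fix \<epsilon> :: real assume \<epsilon>: "\<epsilon> > 0"
    \<comment> \<open>Tightness is phrased with intervals open on the left, so the left endpoint
      lies below 0 to retain a possible atom at 0.\<close>
    have "measure (Fn n) {-1<..A} > 1 - \<epsilon>" for n
    proof -
      interpret real_distribution "Fn n" using Fn by (rule inputs_real_distribution)
      have "measure (Fn n) {0..A} \<le> measure (Fn n) {-1<..A}"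
        by (intro finite_measure_mono) auto
      then show ?thesis using Fn[of n] \<epsilon> by (simp add: inputs_def)
    qed
    then show "\<exists>a b. a < b \<and> (\<forall>n. measure (Fn n) {a<..b} > 1 - \<epsilon>)"
      using A_pos by (intro exI[of _ "-1"] exI[of _ A]) auto
  qed
  from tight_imp_convergent_subsubsequence[OF this strict_mono_id]
  obtain r F where r: "strict_mono r" "real_distribution F" "weak_conv_m (Fn \<circ> r) F" by auto
  moreover have "F \<in> inputs"
    using Fn by (intro inputs_closed[OF _ r(2,3)]) simp
  ultimately show ?thesis using that by blast
qed

section \<open>Uniqueness: midpoints, equality of outputs, recovery of the input\<close>

lemma mixture_inputs:
  assumes F: "F \<in> inputs" and G: "G \<in> inputs"
  shows "mixture F G \<in> inputs"
proof -
  note FG = inputs_real_distribution[OF F] inputs_real_distribution[OF G]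
  interpret F: real_distribution F by (rule FG)
  interpret G: real_distribution G by (rule FG)
  interpret M: real_distribution "mixture F G" by (rule real_distribution_mixture[OF FG])
  have "(\<integral>x. indicat_real {0..A} x \<partial>mixture F G) = 1"
    using F G by (subst integral_mixture[OF FG, where B = 1]) (auto simp: inputs_def indicator_def)
  then show ?thesis
    by (simp add: inputs_def M.real_distribution_axioms)
qed

lemma integral_mixture_inputs:
  fixes g :: "real \<Rightarrow> real"
  assumes F: "F \<in> inputs" and G: "G \<in> inputs" and [measurable]: "g \<in> borel_measurable borel"
    and B: "\<And>x. x \<in> {0..A} \<Longrightarrow> \<bar>g x\<bar> \<le> B"
  shows "(\<integral>x. g x \<partial>mixture F G) = ((\<integral>x. g x \<partial>F) + (\<integral>x. g x \<partial>G)) / 2"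
proof -
  have "(\<integral>x. g (clip x) \<partial>mixture F G) = ((\<integral>x. g (clip x) \<partial>F) + (\<integral>x. g (clip x) \<partial>G)) / 2"
    by (rule integral_mixture[OF inputs_real_distribution[OF F] inputs_real_distribution[OF G] _ B[OF clip_in]])
       measurable
  then show ?thesis
    using integral_clip[OF _ assms(3)] F G mixture_inputs[OF F G] by simp
qed

text \<open>The linear \<open>self_info\<close> parts cancel at the midpoint, so the hypothesis says
  that the pointwise convexity gap of t log t has integral at most 0. The gap is nonnegative, hence
  zero almost everywhere, and strict convexity gives equal densities.\<close>

lemma out_eq_of_info_mixture_le:
  assumes F: "F \<in> inputs" and G: "G \<in> inputs"
    and le: "2 * info (mixture F G) \<le> info F + info G"
  shows "AE y in lborel. out F y = out G y"
proof -
  define M where "M = mixture F G"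
  have M: "M \<in> inputs" unfolding M_def using F G by (rule mixture_inputs)
  have out: "out M y = (out F y + out G y) / 2" for y
  proof -
    have "\<bar>K x y\<bar> \<le> D / (1 + y\<^sup>2)\<^sup>2" if "x \<in> {0..A}" for x
      using admissible_K[OF that, of y] admissible_pos[of y "K x y"] by (auto simp: admissible_def)
    then show ?thesis
      unfolding M_def out_dens_def by (intro integral_mixture_inputs F G measurable_K1)
  qed
  have self: "(\<integral>x. self_info x \<partial>M) = ((\<integral>x. self_info x \<partial>F) + (\<integral>x. self_info x \<partial>G)) / 2"
    unfolding M_def by (rule integral_mixture_inputs[OF F G measurable_self_info self_info_bound])
  define h where "h H y = out H y * ln (out H y)" for H y
  have int: "integrable lborel (h H)" if "H \<in> inputs" for H
    unfolding h_def using that by (intro integrable_admissible_mult_ln measurable_out admissible_out)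
  have pos: "out H y > 0" if "H \<in> inputs" for H y
    using admissible_pos[OF admissible_out[OF that]] .
  define gap where "gap y = h F y + h G y - 2 * h M y" for y
  have gap_nonneg: "gap y \<ge> 0" for y
    using xlnx_midpoint(1)[OF pos[OF F] pos[OF G], of y y] by (simp add: gap_def h_def out)
  have gap_int: "integrable lborel gap"
    unfolding gap_def using int[OF F] int[OF G] int[OF M] by auto
  have "ln 2 * (2 * info M) \<le> ln 2 * (info F + info G)"
    using le unfolding M_def by (intro mult_left_mono) auto
  then have "2 * ((\<integral>x. self_info x \<partial>M) - (\<integral>y. h M y \<partial>lborel)) \<le>
    ((\<integral>x. self_info x \<partial>F) - (\<integral>y. h F y \<partial>lborel)) + ((\<integral>x. self_info x \<partial>G) - (\<integral>y. h G y \<partial>lborel))"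
    unfolding distrib_left mult.left_commute[of "ln 2" 2]
    by (simp add: info_eq[OF F] info_eq[OF G] info_eq[OF M] h_def)
  then have "(\<integral>y. gap y \<partial>lborel) \<le> 0"
    unfolding gap_def using int[OF F] int[OF G] int[OF M] self by (simp add: field_simps)
  moreover have "(\<integral>y. gap y \<partial>lborel) \<ge> 0"
    by (intro integral_nonneg_AE AE_I2 gap_nonneg)
  ultimately have "AE y in lborel. gap y = 0"
    using integral_nonneg_eq_0_iff_AE[OF gap_int] gap_nonneg by (simp add: order_antisym)
  then show ?thesis
  proof eventually_elim
    case (elim y)
    then show ?case
      by (intro xlnx_midpoint(2)[OF pos[OF F] pos[OF G]]) (simp add: gap_def h_def out)
  qed
qed

lemma out_moment:
  assumes F: "F \<in> inputs"
  shows "(\<integral>y. out F y * y ^ n \<partial>lborel) =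
    (\<Sum>j\<le>n. of_nat (n choose j) * \<kappa> ^ j * (\<integral>t. w t * exp (2 * t) ^ j \<partial>lborel)
        * (\<integral>u. noise u * u ^ (n - j) \<partial>lborel) * (\<integral>x. x ^ j \<partial>F))"
proof -
  interpret real_distribution F using F by (rule inputs_real_distribution)
  \<comment> \<open>The locale constant \<open>D\<close> fixes the decay order at 2; here the order
    grows with n so that \<open>1 / (1 + y\<^sup>2)\<close> remains after absorbing
    \<open>\<bar>y\<bar> ^ n\<close>.\<close>
  obtain D' where D': "D' > 0" "\<And>x y. x \<in> {0..A} \<Longrightarrow> K x y \<le> D' / (1 + y\<^sup>2) ^ Suc n"
    using K_upper[of "Suc n"] by metis
  have bound: "\<bar>K x y * y ^ n\<bar> \<le> D' * (1 / (1 + y\<^sup>2))" if x: "x \<in> {0..A}" for x y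
  proof -
    have pos: "1 + y\<^sup>2 > 0" by (simp add: add_pos_nonneg)
    have "K x y * \<bar>y\<bar> ^ n \<le> D' / (1 + y\<^sup>2) ^ Suc n * (1 + y\<^sup>2) ^ n"
      using D' x pos by (intro mult_mono abs_power_le_one_plus_square_power) auto
    also have "\<dots> = D' * (1 / (1 + y\<^sup>2))" using pos by simp
    finally show ?thesis
      using admissible_pos[OF admissible_K[OF x, of y]] by (simp add: abs_mult power_abs)
  qed
  have int: "integrable lborel (\<lambda>y. D' * (1 / (1 + y\<^sup>2)))"
    by (intro integrable_mult_right integrable_inverse_1_plus_square_lborel)
  define a where "a j = of_nat (n choose j) * \<kappa> ^ j * (\<integral>t. w t * exp (2 * t) ^ j \<partial>lborel)
        * (\<integral>u. noise u * u ^ (n - j) \<partial>lborel)" for j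
  have "(\<integral>y. out F y * y ^ n \<partial>lborel) = (\<integral>x. (\<integral>y. K x y * y ^ n \<partial>lborel) \<partial>F)"
    by (rule Fubini_inputs(1)[OF F _ int bound, symmetric]) measurable
  also have "\<dots> = (\<integral>x. (\<Sum>j\<le>n. a j * x ^ j) \<partial>F)"
  proof (rule integral_cong_AE)
    show "AE x in F. (\<integral>y. K x y * y ^ n \<partial>lborel) = (\<Sum>j\<le>n. a j * x ^ j)"
      using AE_inputs[OF F]
    proof eventually_elim
      case (elim x)
      show ?case
        using K_moment[OF elim, of n] unfolding a_def by (subst mult.commute)
    qed
  qed measurable
  also have "\<dots> = (\<Sum>j\<le>n. a j * (\<integral>x. x ^ j \<partial>F))"
  proof -
    have "integrable F (\<lambda>x. x ^ j)" for j
      by (rule integrable_inputs[OF F, where B = "A ^ j"]) (auto intro: power_mono)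
    then show ?thesis by simp
  qed
  finally show ?thesis unfolding a_def .
qed

text \<open>All fading moments are positive, so the moments of the input are recovered recursively
  from those of the output.\<close>
lemma out_determines_input:
  assumes F: "F \<in> inputs" and G: "G \<in> inputs" and eq: "AE y in lborel. out F y = out G y"
  shows "F = G"
proof (rule moments_determine_distribution[OF inputs_real_distribution[OF F] inputs_real_distribution[OF G]])
  show "AE x in F. \<bar>x\<bar> \<le> A" using AE_inputs[OF F] by eventually_elim simp
  show "AE x in G. \<bar>x\<bar> \<le> A" using AE_inputs[OF G] by eventually_elim simp
  show "(\<integral>x. x ^ n \<partial>F) = (\<integral>x. x ^ n \<partial>G)" for n
  proof (induction n rule: less_induct)
    case (less n)
    define a where "a j = of_nat (n choose j) * \<kappa> ^ j * (\<integral>t. w t * exp (2 * t) ^ j \<partial>lborel)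
        * (\<integral>u. noise u * u ^ (n - j) \<partial>lborel)" for j
    have "(\<integral>t. w t * exp (2 * t) ^ n \<partial>lborel) > 0"
      using sl_pos by (intro integral_pos_lborel integrable_w_exp_power mult_pos_pos normal_density_pos) auto
    \<comment> \<open>For j = n the binomial coefficient is 1 and the noise integral is the total
      mass 1, leaving \<open>\<kappa> ^ n\<close> times a positive fading moment.\<close>
    then have a: "a n \<noteq> 0"
      using \<kappa>_pos integral_normal_density[OF sg_pos, of 0]
      unfolding a_def diff_self_eq_0 power_0 mult_1_right by simp
    have "(\<integral>y. out F y * y ^ n \<partial>lborel) = (\<integral>y. out G y * y ^ n \<partial>lborel)"
    proof (rule integral_cong_AE)
      show "AE y in lborel. out F y * y ^ n = out G y * y ^ n"
        using eq by eventually_elim simp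
    qed (use measurable_out[OF F] measurable_out[OF G] in simp_all)
    then have "(\<Sum>j\<le>n. a j * (\<integral>x. x ^ j \<partial>F)) = (\<Sum>j\<le>n. a j * (\<integral>x. x ^ j \<partial>G))"
      unfolding out_moment[OF F] out_moment[OF G] a_def .
    moreover have "(\<Sum>j<n. a j * (\<integral>x. x ^ j \<partial>F)) = (\<Sum>j<n. a j * (\<integral>x. x ^ j \<partial>G))"
      using less.IH by (intro sum.cong) auto
    ultimately show ?case
      unfolding lessThan_Suc_atMost[symmetric] sum.lessThan_Suc using a by auto
  qed
qed

end

section \<open>Existence of a maximizer and the constrained problem\<close>

lemma ex_maximizer_of_sequentially_compact:
  fixes f :: "'a \<Rightarrow> real"
  assumes ne: "S \<noteq> {}" and bdd: "bdd_above (f ` S)"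
    and compact: "\<And>X :: nat \<Rightarrow> 'a. (\<And>n. X n \<in> S) \<Longrightarrow>
      \<exists>r x. strict_mono (r :: nat \<Rightarrow> nat) \<and> x \<in> S \<and> (\<lambda>n. f (X (r n))) \<longlonglongrightarrow> f x"
  shows "\<exists>x\<in>S. f x = (SUP x\<in>S. f x)"
proof -
  define s where "s = (SUP x\<in>S. f x)"
  have "\<exists>x. x \<in> S \<and> s - inverse (real (Suc n)) < f x" for n
  proof -
    have "s - inverse (real (Suc n)) < s" by simp
    then show ?thesis unfolding s_def less_cSUP_iff[OF ne bdd] by blast
  qed
  then obtain X where X: "\<And>n. X n \<in> S \<and> s - inverse (real (Suc n)) < f (X n)"
    using choice[of "\<lambda>n x. x \<in> S \<and> s - inverse (real (Suc n)) < f x"] by auto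
  \<comment> \<open>Compactness is phrased through the values of \<open>f\<close> along a
    subsequence, so the lemma applies to measures with weak convergence given as a bare
    relation.\<close>
  from compact[of X] X
  obtain r x where r: "strict_mono r" and x: "x \<in> S" and lim: "(\<lambda>n. f (X (r n))) \<longlonglongrightarrow> f x"
    by auto
  have "(\<lambda>n. f (X n)) \<longlonglongrightarrow> s"
  proof (rule tendsto_sandwich)
    show "(\<lambda>n. s - inverse (real (Suc n))) \<longlonglongrightarrow> s"
      using tendsto_diff[OF tendsto_const LIMSEQ_inverse_real_of_nat, of s] by simp
    show "\<forall>\<^sub>F n in sequentially. s - inverse (real (Suc n)) \<le> f (X n)"
      using X by (intro always_eventually allI less_imp_le) blast
    show "\<forall>\<^sub>F n in sequentially. f (X n) \<le> s"
      unfolding s_def using X by (intro always_eventually allI cSUP_upper bdd) blast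
  qed simp
  from LIMSEQ_subseq_LIMSEQ[OF this r] have "s = f x"
    unfolding o_def using lim by (rule LIMSEQ_unique)
  then show ?thesis using x unfolding s_def by (intro bexI[of _ x]) (rule sym)
qed

context fading_channel_bounds
begin

lemma feasible_iff:
  "F \<in> feasible A \<epsilon> Eth b c \<longleftrightarrow>
    F \<in> inputs \<and> (\<integral>x. x \<partial>F) \<le> \<epsilon> \<and> Eth \<le> (\<integral>x. b * x * ln (1 + c * x) \<partial>F)"
  by (auto simp: feasible_def inputs_def real_distribution_def real_distribution_axioms_def)

lemma continuous_harvest: "c > 0 \<Longrightarrow> continuous_on {0..A} (\<lambda>x. b * x * ln (1 + c * x))"
  by (intro continuous_intros) (auto simp: add_pos_nonneg intro!: less_imp_neq[symmetric])

text \<open>Both constraints are linear in the input law, so they pass to midpoints.\<close>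

lemma feasible_mixture:
  assumes c: "c > 0" and F: "F \<in> feasible A \<epsilon> Eth b c" and G: "G \<in> feasible A \<epsilon> Eth b c"
  shows "mixture F G \<in> feasible A \<epsilon> Eth b c"
proof -
  have FG: "F \<in> inputs" "G \<in> inputs" using F G by (auto simp: feasible_iff)
  have "bounded ((\<lambda>x. b * x * ln (1 + c * x)) ` {0..A})"
    by (intro compact_imp_bounded compact_continuous_image continuous_harvest c compact_Icc)
  then obtain B where B: "\<And>x. x \<in> {0..A} \<Longrightarrow> \<bar>b * x * ln (1 + c * x)\<bar> \<le> B"
    unfolding bounded_iff real_norm_def by blast
  have "(\<integral>x. x \<partial>mixture F G) = ((\<integral>x. x \<partial>F) + (\<integral>x. x \<partial>G)) / 2"
    by (intro integral_mixture_inputs[OF FG, where B = A]) auto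
  moreover have "(\<integral>x. b * x * ln (1 + c * x) \<partial>mixture F G) =
     ((\<integral>x. b * x * ln (1 + c * x) \<partial>F) + (\<integral>x. b * x * ln (1 + c * x) \<partial>G)) / 2"
    by (intro integral_mixture_inputs[OF FG _ B]) auto
  ultimately show ?thesis
    using F G mixture_inputs[OF FG] by (auto simp: feasible_iff)
qed

text \<open>Both constraints are weak inequalities between a constant and the integral of a function
  continuous on [0, A], so they pass to weak limits.\<close>

lemma feasible_closed:
  assumes c: "c > 0" and Fn: "\<And>n. Fn n \<in> feasible A \<epsilon> Eth b c"
    and F: "F \<in> inputs" and conv: "weak_conv_m Fn F"
  shows "F \<in> feasible A \<epsilon> Eth b c"
proof -
  have inp: "Fn n \<in> inputs" for n using Fn by (simp add: feasible_iff)
  have "(\<lambda>n. \<integral>x. x \<partial>Fn n) \<longlonglongrightarrow> (\<integral>x. x \<partial>F)"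
    by (intro integral_weak_conv[OF inp F conv] continuous_on_id) auto
  then have "(\<integral>x. x \<partial>F) \<le> \<epsilon>"
    using Fn by (intro LIMSEQ_le_const2) (auto simp: feasible_iff)
  moreover have "(\<lambda>n. \<integral>x. b * x * ln (1 + c * x) \<partial>Fn n) \<longlonglongrightarrow> (\<integral>x. b * x * ln (1 + c * x) \<partial>F)"
    by (intro integral_weak_conv[OF inp F conv] continuous_harvest c) auto
  then have "Eth \<le> (\<integral>x. b * x * ln (1 + c * x) \<partial>F)"
    using Fn by (intro LIMSEQ_le_const) (auto simp: feasible_iff)
  ultimately show ?thesis using F by (simp add: feasible_iff)
qed

lemma capacity_achieved_uniquely:
  assumes c: "c > 0" and ne: "feasible A \<epsilon> Eth b c \<noteq> {}"
  shows "bdd_above (info ` feasible A \<epsilon> Eth b c)"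
    and "\<exists>!F. F \<in> feasible A \<epsilon> Eth b c \<and> info F = (SUP G \<in> feasible A \<epsilon> Eth b c. info G)"
proof -
  let ?\<Omega> = "feasible A \<epsilon> Eth b c"
  have inp: "F \<in> inputs" if "F \<in> ?\<Omega>" for F using that by (simp add: feasible_iff)
  show bdd: "bdd_above (info ` ?\<Omega>)"
    using info_le[OF inp] by (intro bdd_aboveI2)
  show "\<exists>!F. F \<in> ?\<Omega> \<and> info F = (SUP G \<in> ?\<Omega>. info G)"
  proof (rule ex_ex1I)
    have "\<exists>r F. strict_mono (r :: nat \<Rightarrow> nat) \<and> F \<in> ?\<Omega> \<and> (\<lambda>n. info (Fn (r n))) \<longlonglongrightarrow> info F"
      if Fn: "\<And>n. Fn n \<in> ?\<Omega>" for Fn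
    proof -
      obtain r F where r: "strict_mono (r :: nat \<Rightarrow> nat)" "F \<in> inputs" "weak_conv_m (Fn \<circ> r) F"
        by (rule inputs_seq_compact[OF inp[OF Fn]])
      have sub: "(Fn \<circ> r) n \<in> ?\<Omega>" for n using Fn by simp
      have "F \<in> ?\<Omega>" by (rule feasible_closed[OF c sub r(2,3)])
      moreover have "(\<lambda>n. info (Fn (r n))) \<longlonglongrightarrow> info F"
        using info_weak_conv[OF inp[OF sub] r(2,3)] by (simp add: o_def)
      ultimately show ?thesis using r(1) by blast
    qed
    from ex_maximizer_of_sequentially_compact[OF ne bdd this]
    show "\<exists>F. F \<in> ?\<Omega> \<and> info F = (SUP G \<in> ?\<Omega>. info G)" by auto
  next
    fix F G
    assume F: "F \<in> ?\<Omega> \<and> info F = (SUP G \<in> ?\<Omega>. info G)" and G: "G \<in> ?\<Omega> \<and> info G = (SUP G \<in> ?\<Omega>. info G)"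
    \<comment> \<open>The midpoint is feasible and cannot exceed the supremum, which
      \<open>F\<close> and \<open>G\<close> both attain; this is the reverse of strict
      concavity.\<close>
    have "info (mixture F G) \<le> (SUP G \<in> ?\<Omega>. info G)"
      using F G by (intro cSUP_upper bdd feasible_mixture c) auto
    then have "2 * info (mixture F G) \<le> info F + info G" using F G by simp
    then show "F = G"
      using F G inp by (intro out_determines_input out_eq_of_info_mixture_le) auto
  qed
qed

end

theorem theorem1:
  fixes A \<epsilon> Eth b c \<kappa> sl sg :: real
  assumes "A > 0" and "\<epsilon> > 0" and "Eth \<ge> 0" and "b > 0" and "c > 0" and "\<kappa> > 0"
    and "sl > 0" and "sg > 0"
    and "feasible A \<epsilon> Eth b c \<noteq> {}"
  shows "bdd_above (mutual_info \<kappa> sl sg ` feasible A \<epsilon> Eth b c) \<and>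
         (\<exists>!F. F \<in> feasible A \<epsilon> Eth b c \<and>
                mutual_info \<kappa> sl sg F = (SUP G \<in> feasible A \<epsilon> Eth b c. mutual_info \<kappa> sl sg G))"
proof -
  interpret fading_channel \<kappa> sl sg A
    using assms by unfold_locales
  \<comment> \<open>Order 2: one power of \<open>1 + y\<^sup>2\<close> pays for the growth of the
    logarithm, the other keeps the integrand integrable.\<close>
  obtain D where "D > 0" "\<And>x y. x \<in> {0..A} \<Longrightarrow> K x y \<le> D / (1 + y\<^sup>2)\<^sup>2"
    using K_upper[of 2] by metis
  moreover obtain C where "C > 0" "\<And>x y. x \<in> {0..A} \<Longrightarrow> exp (- (C * (1 + y\<^sup>2))) \<le> K x y"
    using K_lower by metis
  ultimately interpret fading_channel_bounds \<kappa> sl sg A D C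
    by unfold_locales
  show ?thesis
    using capacity_achieved_uniquely[OF \<open>c > 0\<close> assms(9)] by (rule conjI)
qed

end
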